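(* Let $n\ge 1$ be an integer. All the Goldbach couples of $2n$ are found as follows. 1) If $n\in P$, then $(n,n)$ is a Goldbach couple of $2n$ (the trivial one). 2) If $2n-1\in P$, then $(1,2n-1)$ is a Goldbach couple of $2n$ (the Noether-Goldbach couple). 3) If $n>3$, all the other possible Goldbach couples of $2n$ are identified by means of the maximal ideals of $\mathbb{Z}_r$ belonging to the set $\{\mathfrak{a}_i\}$; that is, up to order, the Goldbach couples of $2n$ different from $(n,n)$ and $(1,2n-1)$ are exactly the pairs $(2n-b_i,b_i)$ for which the ideal $\mathfrak{a}_i=(2n-b_i)\mathbb{Z}/r\mathbb{Z}$ is a maximal ideal of $\mathbb{Z}_r$.
   Context: Convention: the number $1$ is regarded as a prime, and $P\subset\mathbb{N}$ is the set of prime numbers, including $1$. A Goldbach couple of $2n$ is a pair $(p_1,p_2)$ of elements of $P$ with $p_1+p_2=2n$; it is called trivial if $p_1=p_2=n$. For $m\ge1$ write $\mathbb{Z}_m=\mathbb{Z}/m\mathbb{Z}$. Given $n$, let $a_1,\dots,a_k$ be the integers $a$ with $1<a<2n-1$ and $\gcd(a,2n)=1$, and let the $b_i$ be those among $a_1,\dots,a_k$ that are prime. Put $r=\operatorname{lcm}(a_1,\dots,a_k)$. For each $b_i$ the integer $2n-b_i$ is again one of the $a_j$ and hence divides $r$; define the ideal $\mathfrak{a}_i=(2n-b_i)\mathbb{Z}/r\mathbb{Z}\subset\mathbb{Z}_r$. The set $\{\mathfrak{a}_i\}$ is the set of all these ideals. *)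

theory Defs
  imports "HOL-Algebra.IntRing"
begin

text \<open>The convention that 1 counts as a prime is in force.\<close>

definition primes1 :: "nat set" where
  "primes1 = {p. p = 1 \<or> prime p}"

definition goldbach_couple :: "nat \<Rightarrow> nat \<times> nat \<Rightarrow> bool" where
  "goldbach_couple n c \<longleftrightarrow> fst c \<in> primes1 \<and> snd c \<in> primes1 \<and> fst c + snd c = 2 * n"

text \<open>The integers \<open>a\<^sub>1, \<dots>, a\<^sub>k\<close>, those \<open>b\<^sub>i\<close> among them that are prime, and \<open>r\<close>.
  If there are no \<open>a\<^sub>i\<close>, then \<open>r = 1\<close>.\<close>

definition a_set :: "nat \<Rightarrow> nat set" where
  "a_set n = {a. 1 < a \<and> a < 2 * n - 1 \<and> gcd a (2 * n) = 1}"

definition b_set :: "nat \<Rightarrow> nat set" where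
  "b_set n = a_set n \<inter> primes1"

definition r_of :: "nat \<Rightarrow> nat" where
  "r_of n = Lcm (a_set n)"

text \<open>The ideal \<open>d\<int>/r\<int>\<close> of \<^term>\<open>ZFact r\<close>: the set of cosets \<open>r\<int> + x\<close> with \<open>x \<in> d\<int>\<close>
  (meaningful when \<open>d\<close> divides \<open>r\<close>).\<close>

definition quot_ideal :: "int \<Rightarrow> int \<Rightarrow> int set set" where
  "quot_ideal d r = (\<lambda>x. Idl\<^bsub>\<Z>\<^esub> {r} +>\<^bsub>\<Z>\<^esub> x) ` (Idl\<^bsub>\<Z>\<^esub> {d})"

definition a_ideal :: "nat \<Rightarrow> nat \<Rightarrow> int set set" where
  "a_ideal n b = quot_ideal (int (2 * n - b)) (int (r_of n))"

lemma b_set_complement: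
  assumes "b \<in> b_set n"
  shows "2 * n - b \<in> a_set n" and "2 * n - b dvd r_of n"
proof -
  have b: "1 < b" "b < 2 * n - 1" "gcd b (2 * n) = 1"
    using assms by (auto simp: b_set_def a_set_def)
  have "gcd (2 * n - b) (2 * n) = gcd b (2 * n)"
    using b gcd_diff2_nat[of b "2 * n"] by (metis add_diff_inverse_nat diff_le_self gcd.commute
      gcd_add1 gcd_diff1_nat less_imp_le_nat not_less order.strict_trans2)
  then show *: "2 * n - b \<in> a_set n"
    using b by (auto simp: a_set_def)
  then show "2 * n - b dvd r_of n"
    by (simp add: r_of_def dvd_Lcm)
qed

end

theory Submission
  imports Defs
begin

text \<open>
  Call a couple nontrivial if it is not \<open>(n, n)\<close> and does not contain \<open>1\<close>. Its two members are
  distinct primes in the usual sense, hence coprime, and therefore each of them is coprime to their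
  sum \<open>2n\<close>; so both are among the \<open>b\<^sub>i\<close>. What remains is to decide, for
  a given \<open>b\<^sub>i\<close>, whether the number \<open>d = 2n - b\<^sub>i\<close> is prime, and this is what maximality of
  \<open>d\<int>/r\<int>\<close> detects: ideals of \<open>\<int>\<^sub>r\<close> correspond to ideals of \<open>\<int>\<close> containing \<open>r\<int>\<close>, in an
  order-preserving way, so \<open>d\<int>/r\<int>\<close> is maximal exactly if \<open>d\<int>\<close> is
  (\<open>maximalideal_quot_iff\<close>), and this means that \<open>d\<close> is prime (\<open>maximalideal_int_iff_prime\<close>).
  Divisibility of \<open>r\<close> by \<open>d\<close>, which makes \<open>d\<int>\<close> contain \<open>r\<int>\<close>, holds because \<open>d\<close> is itself
  one of the \<open>a\<^sub>j\<close>.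
\<close>

text \<open>Taking images under the projection is an isomorphism of ordered sets from the ideals
  containing \<open>I\<close> to all ideals of the quotient, and it sends the whole ring to the whole quotient.
  Maximality is a property of this order alone.\<close>

lemma maximalideal_quot_iff:
  fixes R (structure)
  assumes I: "ideal I R" and J: "ideal J R" and IJ: "I \<subseteq> J"
  shows "maximalideal ((+>) I ` J) (R Quot I) \<longleftrightarrow> maximalideal J R"
proof -
  interpret ring R
    using I by (rule ideal.axioms(2))
  let ?h = "\<lambda>K. (+>) I ` K"
  have bij: "bij_betw ?h {K. ideal K R \<and> I \<subseteq> K} {K. ideal K (R Quot I)}"
    by (rule quot_ideal_correspondence[OF I])
  have inj: "K = L" if "?h K = ?h L" "ideal K R" "I \<subseteq> K" "ideal L R" "I \<subseteq> L" for K L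
    using inj_onD[OF bij_betw_imp_inj_on[OF bij] that(1)] that(2-) by simp
  have whole: "?h (carrier R) = carrier (R Quot I)"
    by (auto simp: FactRing_def A_RCOSETS_def')
  have I_sub: "I \<subseteq> carrier R"
    using I by (meson additive_subgroup.a_subset ideal.axioms(1))
  show ?thesis
  proof
    assume max: "maximalideal (?h J) (R Quot I)"
    show "maximalideal J R"
    proof (rule maximalidealI[OF J])
      show "carrier R \<noteq> J"
        using maximalideal.I_notcarr[OF max] whole by auto
      fix K assume K: "ideal K R" "J \<subseteq> K" "K \<subseteq> carrier R"
      have "?h K = ?h J \<or> ?h K = ?h (carrier R)"
        unfolding whole
      proof (rule maximalideal.I_maximal[OF max])
        show "ideal (?h K) (R Quot I)"
          by (rule ring_ideal_imp_quot_ideal[OF I K(1)])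
        show "?h J \<subseteq> ?h K"
          by (rule image_mono[OF K(2)])
        show "?h K \<subseteq> carrier (R Quot I)"
          using image_mono[OF K(3)] whole by metis
      qed
      then show "K = J \<or> K = carrier R"
        using inj[OF _ K(1) order_trans[OF IJ K(2)] J IJ]
          inj[OF _ K(1) order_trans[OF IJ K(2)] oneideal I_sub] by blast
    qed
  next
    assume max: "maximalideal J R"
    show "maximalideal (?h J) (R Quot I)"
    proof (rule maximalidealI)
      show "ideal (?h J) (R Quot I)"
        by (rule ring_ideal_imp_quot_ideal[OF I J])
      show "carrier (R Quot I) \<noteq> ?h J"
        using maximalideal.I_notcarr[OF max] inj[OF _ oneideal I_sub J IJ] whole by auto
      fix K' assume K': "ideal K' (R Quot I)" "?h J \<subseteq> K'" "K' \<subseteq> carrier (R Quot I)"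
      then have "K' \<in> ?h ` {K. ideal K R \<and> I \<subseteq> K}"
        using bij by (simp add: bij_betw_def)
      then obtain K where K: "ideal K R" "I \<subseteq> K" "K' = ?h K"
        by blast
      \<comment> \<open>An ideal containing \<open>I\<close> is the union of its own cosets modulo \<open>I\<close>, so the inclusion of
        images lifts.\<close>
      have "J = \<Union> (?h J)" "K = \<Union> (?h K)"
        using ideal_incl_iff[OF I J] ideal_incl_iff[OF I K(1)] IJ K(2) by auto
      then have "J \<subseteq> K"
        using K'(2) K(3) by (metis Sup_subset_mono)
      then have "K = J \<or> K = carrier R"
        using maximalideal.I_maximal[OF max K(1)] K(1)
        by (meson additive_subgroup.a_subset ideal.axioms(1))
      then show "K' = ?h J \<or> K' = carrier (R Quot I)"
        using K(3) whole by auto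
    qed
  qed
qed

lemma mem_int_Idl_iff: "x \<in> Idl\<^bsub>\<Z>\<^esub> {d} \<longleftrightarrow> d dvd x"
  by (auto simp: int_Idl dvd_def mult.commute)

lemma ideal_int_Idl: "ideal (Idl\<^bsub>\<Z>\<^esub> {d}) \<Z>"
  by (rule int.genideal_ideal) simp

text \<open>A divisor of \<open>d\<close> generates an ideal above \<open>d\<int>\<close>, so maximality leaves only trivial divisors.
  Conversely, an element outside \<open>p\<int>\<close> is coprime to \<open>p\<close>, and by Bezout's identity an ideal
  containing both contains \<open>1\<close>. The sign matters because \<open>-p\<close> generates the same ideal as \<open>p\<close>,
  while \<^const>\<open>prime\<close> holds for normalized elements only.\<close>

lemma maximalideal_int_iff_prime:
  fixes d :: int
  assumes "d > 0"
  shows "maximalideal (Idl\<^bsub>\<Z>\<^esub> {d}) \<Z> \<longleftrightarrow> prime d"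
proof
  assume max: "maximalideal (Idl\<^bsub>\<Z>\<^esub> {d}) \<Z>"
  have "d \<noteq> 1"
    using maximalideal.I_notcarr[OF max] by (auto simp: mem_int_Idl_iff)
  moreover have "e = 1 \<or> e = d" if e: "e \<ge> 0" "e dvd d" for e
  proof -
    have "Idl\<^bsub>\<Z>\<^esub> {e} = Idl\<^bsub>\<Z>\<^esub> {d} \<or> Idl\<^bsub>\<Z>\<^esub> {e} = carrier \<Z>"
      using e by (intro maximalideal.I_maximal[OF max] ideal_int_Idl) (simp_all add: Idl_subset_eq_dvd)
    then show ?thesis
    proof
      assume "Idl\<^bsub>\<Z>\<^esub> {e} = Idl\<^bsub>\<Z>\<^esub> {d}"
      then show ?thesis
        using e assms by (simp add: Idl_eq_abs)
    next
      assume "Idl\<^bsub>\<Z>\<^esub> {e} = carrier \<Z>"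
      then have "e dvd 1"
        using mem_int_Idl_iff[of 1 e] by simp
      then show ?thesis
        using e by simp
    qed
  qed
  ultimately show "prime d"
    using assms by (auto simp: prime_int_iff)
next
  assume p: "prime d"
  show "maximalideal (Idl\<^bsub>\<Z>\<^esub> {d}) \<Z>"
  proof (rule maximalidealI[OF ideal_int_Idl])
    show "carrier \<Z> \<noteq> Idl\<^bsub>\<Z>\<^esub> {d}"
      by (rule primeideal.I_notcarr[OF prime_primeideal[OF p]])
    fix J assume J: "ideal J \<Z>" "Idl\<^bsub>\<Z>\<^esub> {d} \<subseteq> J"
    interpret J: ideal J \<Z> by (rule J(1))
    show "J = Idl\<^bsub>\<Z>\<^esub> {d} \<or> J = carrier \<Z>"
    proof (cases "J \<subseteq> Idl\<^bsub>\<Z>\<^esub> {d}")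
      case False
      then obtain x where x: "x \<in> J" "\<not> d dvd x"
        using mem_int_Idl_iff by blast
      then have "coprime d x"
        using p by (simp add: prime_imp_coprime)
      then obtain u v where uv: "u * d + v * x = 1"
        using bezout_int[of d x] by auto
      have "d \<in> J"
        using J(2) mem_int_Idl_iff[of d d] by auto
      then have "u * d + v * x \<in> J"
        using x(1) J.I_l_closed[of d u] J.I_l_closed[of x v] J.a_closed by simp
      then have "1 \<in> J"
        using uv by simp
      then show ?thesis
        using J.one_imp_carrier by simp
    qed (use J(2) in auto)
  qed
qed

lemma maximalideal_quot_ideal_iff_prime:
  fixes d r :: int
  assumes "d > 0" and "d dvd r"
  shows "maximalideal (quot_ideal d r) (ZFact r) \<longleftrightarrow> prime d"
  unfolding quot_ideal_def ZFact_def
  using maximalideal_quot_iff[OF ideal_int_Idl ideal_int_Idl, of r d] assms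
  by (simp add: Idl_subset_eq_dvd maximalideal_int_iff_prime)

lemma maximalideal_a_ideal_iff:
  assumes "b \<in> b_set n"
  shows "maximalideal (a_ideal n b) (ZFact (int (r_of n))) \<longleftrightarrow> prime (2 * n - b)"
proof -
  have "2 * n - b > 0"
    using b_set_complement(1)[OF assms] by (auto simp: a_set_def)
  then show ?thesis
    unfolding a_ideal_def
    using b_set_complement(2)[OF assms] by (subst maximalideal_quot_ideal_iff_prime) (simp_all del: of_nat_diff)
qed

text \<open>Distinct primes \<open>p\<close> and \<open>q\<close> are coprime, hence both are coprime to \<open>p + q\<close>; and neither is
  as large as \<open>p + q - 1\<close>, since the other exceeds \<open>1\<close>.\<close>

lemma distinct_primes_in_b_set:
  assumes "prime p" "prime q" "p \<noteq> q" "p + q = 2 * n"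
  shows "p \<in> b_set n"
proof -
  have "gcd p (p + q) = 1"
    using primes_coprime[OF assms(1-3)] by (simp add: coprime_iff_gcd_eq_1)
  then show ?thesis
    using assms prime_gt_1_nat[of p] prime_gt_1_nat[of q]
    by (auto simp: b_set_def a_set_def primes1_def)
qed

lemma b_setD:
  assumes "b \<in> b_set n"
  shows "prime b" "b < 2 * n - 1" "b \<noteq> n" "3 \<le> b"
proof -
  have b: "1 < b" "b < 2 * n - 1" "gcd b (2 * n) = 1" "b \<in> primes1"
    using assms by (simp_all add: b_set_def a_set_def)
  then show "prime b" "b < 2 * n - 1" "b \<noteq> n"
    by (auto simp: primes1_def)
  have "b \<noteq> 2"
    using b(3) by auto
  then show "3 \<le> b"
    using b(1) by simp
qed

lemma nontrivial_goldbach_couple_iff: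
  assumes "n \<ge> 1"
  shows "goldbach_couple n c \<and> c \<notin> {(n, n), (1, 2 * n - 1), (2 * n - 1, 1)} \<longleftrightarrow>
    (\<exists>p q. c = (p, q) \<and> prime p \<and> prime q \<and> p \<noteq> q \<and> p + q = 2 * n)"
proof (cases c)
  case (Pair p q)
  show ?thesis
  proof (cases "p + q = 2 * n")
    case True
    have "(p, q) = (n, n) \<longleftrightarrow> p = q" "(p, q) = (1, 2 * n - 1) \<longleftrightarrow> p = 1"
      "(p, q) = (2 * n - 1, 1) \<longleftrightarrow> q = 1"
      using True assms by auto
    moreover have "prime x \<longleftrightarrow> x \<in> primes1 \<and> x \<noteq> 1" for x :: nat
      by (auto simp: primes1_def)
    ultimately show ?thesis
      using True by (simp add: Pair goldbach_couple_def) blast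
  qed (simp add: Pair goldbach_couple_def)
qed

text \<open>A nontrivial couple consists of distinct primes coprime to \<open>2n\<close>, in particular odd ones, so
  that \<open>2n\<close> is at least \<open>3 + 5\<close>.\<close>

lemma goldbach_couple_small:
  assumes "1 \<le> n" "n \<le> 3" "goldbach_couple n c"
  shows "c \<in> {(n, n), (1, 2 * n - 1), (2 * n - 1, 1)}"
proof (rule ccontr)
  assume "c \<notin> {(n, n), (1, 2 * n - 1), (2 * n - 1, 1)}"
  with assms(3) have "goldbach_couple n c \<and> c \<notin> {(n, n), (1, 2 * n - 1), (2 * n - 1, 1)}"
    by (rule conjI)
  then obtain p q where pq: "prime p" "prime q" "p \<noteq> q" "p + q = 2 * n"
    unfolding nontrivial_goldbach_couple_iff[OF assms(1)] by blast
  have "3 \<le> p"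
    by (rule b_setD(4)[OF distinct_primes_in_b_set[OF pq]])
  moreover have "3 \<le> q"
    using b_setD(4)[OF distinct_primes_in_b_set[of q p n]] pq by (simp add: add.commute)
  ultimately show False
    using pq(3,4) assms(2) by linarith
qed

text \<open>Maximality is tested on the first component of \<open>(2n - b, b)\<close>, while membership of \<open>b\<close> in the
  list already makes the second one prime.\<close>

lemma nontrivial_goldbach_couple_iff_maximalideal:
  assumes "n \<ge> 1"
  shows "goldbach_couple n c \<and> c \<notin> {(n, n), (1, 2 * n - 1), (2 * n - 1, 1)} \<longleftrightarrow>
    (\<exists>b \<in> b_set n. maximalideal (a_ideal n b) (ZFact (int (r_of n))) \<and>
      (c = (2 * n - b, b) \<or> c = (b, 2 * n - b)))"
  (is "_ \<longleftrightarrow> ?R")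
  unfolding nontrivial_goldbach_couple_iff[OF assms]
proof
  assume "\<exists>p q. c = (p, q) \<and> prime p \<and> prime q \<and> p \<noteq> q \<and> p + q = 2 * n"
  then obtain p q where pq: "c = (p, q)" "prime p" "prime q" "p \<noteq> q" "p + q = 2 * n"
    by blast
  have q: "q \<in> b_set n"
    using distinct_primes_in_b_set[of q p n] pq by (simp add: add.commute)
  have "2 * n - q = p"
    using pq(5) by simp
  then show ?R
    using q pq(1,2) by (intro bexI[OF _ q]) (simp add: maximalideal_a_ideal_iff)
next
  assume ?R
  then obtain b where b: "b \<in> b_set n" "prime (2 * n - b)"
    "c = (2 * n - b, b) \<or> c = (b, 2 * n - b)"
    by (auto simp: maximalideal_a_ideal_iff)
  moreover have "2 * n - b \<noteq> b" "2 * n - b + b = 2 * n"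
    using b_setD[OF b(1)] by auto
  ultimately show "\<exists>p q. c = (p, q) \<and> prime p \<and> prime q \<and> p \<noteq> q \<and> p + q = 2 * n"
    using b_setD(1)[OF b(1)] by (metis add.commute)
qed

theorem corollary2p53:
  fixes n :: nat
  assumes "n \<ge> 1"
  shows "(n \<in> primes1 \<longrightarrow> goldbach_couple n (n, n)) \<and>
    (2 * n - 1 \<in> primes1 \<longrightarrow> goldbach_couple n (1, 2 * n - 1)) \<and>
    (n \<le> 3 \<longrightarrow> (\<forall>c. goldbach_couple n c \<longrightarrow> c \<in> {(n, n), (1, 2 * n - 1), (2 * n - 1, 1)})) \<and>
    (n > 3 \<longrightarrow> (\<forall>c.
       goldbach_couple n c \<and> c \<notin> {(n, n), (1, 2 * n - 1), (2 * n - 1, 1)} \<longleftrightarrow>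
       (\<exists>b \<in> b_set n. maximalideal (a_ideal n b) (ZFact (int (r_of n))) \<and>
          (c = (2 * n - b, b) \<or> c = (b, 2 * n - b)))))"
proof (intro conjI impI allI)
  show "goldbach_couple n (n, n)" if "n \<in> primes1"
    using that by (simp add: goldbach_couple_def)
  show "goldbach_couple n (1, 2 * n - 1)" if "2 * n - 1 \<in> primes1"
    using that assms by (simp add: goldbach_couple_def primes1_def)
  show "c \<in> {(n, n), (1, 2 * n - 1), (2 * n - 1, 1)}" if "n \<le> 3" "goldbach_couple n c" for c
    by (rule goldbach_couple_small[OF assms that])
qed (rule nontrivial_goldbach_couple_iff_maximalideal[OF assms])

end
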